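(* Assume that, as $p\to\infty$ through the odd primes, $\sup_{j\in\mathbb{F}_p^\times}\Lambda_{S_j}(\vartheta)\to\Lambda_\flat(\vartheta)$ uniformly for $0\le\vartheta\le4$, where $$\Lambda_\flat(\vartheta)=\begin{cases}0,&0\le\vartheta<2,\\ \frac{\vartheta-2}{2},&2\le\vartheta\le3,\\ \frac12,&3<\vartheta\le4.\end{cases}$$ Then for every $r>3$ one has $R_{S_j}^*(2\to r)\lesssim_r1$ uniformly for all odd primes $p$ and all $j\in\mathbb{F}_p^\times$; that is, there is a constant $C_r$ depending only on $r$ such that $\|(f\,d\sigma_j)^\vee\|_{L^r(\mathbb{F}_p^4)}\le C_r\|f\|_{L^2(S_j,d\sigma_j)}$ for all odd primes $p$, all $j\in\mathbb{F}_p^\times$ and all $f:S_j\to\mathbb{C}$.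
   Context: The hypothesis is the paper's Localized Spherical Restriction/Extension Conjecture. For an odd prime $p$, let $\chi(y)=e^{2\pi i y/p}$ on $\mathbb{F}_p$, $Q_4(x)=x_1^2+\dots+x_4^2$, and for $j\in\mathbb{F}_p^\times$ let $S_j=\{x\in\mathbb{F}_p^4:Q_4(x)=j\}$ with uniform probability measure $d\sigma_j$, so $\|f\|_{L^2(S_j,d\sigma_j)}=\big(\frac1{|S_j|}\sum_{\xi\in S_j}|f(\xi)|^2\big)^{1/2}$. Let $(f\,d\sigma_j)^\vee(x)=\frac1{|S_j|}\sum_{y\in S_j}f(y)\chi(y\cdot x)$. The spaces $L^r(\mathbb{F}_p^4)$ and $L^2(E)$ ($E\subseteq\mathbb{F}_p^4$) use counting measure. For $0\le\vartheta\le4$, $\Lambda_{S_j}(\vartheta)$ is the infimum of all $\lambda\ge0$ such that for every $E\subseteq\mathbb{F}_p^4$ with $1\le|E|\le p^\vartheta$ and every $f:S_j\to\mathbb{C}$, $\|(f\,d\sigma_j)^\vee\|_{L^2(E)}\le p^\lambda\|f\|_{L^2(S_j,d\sigma_j)}$. Equivalently (by duality), it is the infimum of $\lambda\ge0$ such that for every such $E$ and every $g$ supported on $E$, $\|\widehat g\|_{L^2(S_j,d\sigma_j)}\le p^\lambda\|g\|_{L^2(\mathbb{F}_p^4)}$, where $\widehat g(\xi)=\sum_x g(x)\chi(-x\cdot\xi)$. *)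

theory Defs
  imports "HOL-Analysis.Analysis" "HOL-Number_Theory.Cong" "HOL-Computational_Algebra.Primes"
begin

text \<open>
  Since the prime \<open>p\<close> varies inside the statement, \<open>\<int>/p\<int>\<close> cannot be a type depending on it.
  Elements of the prime field are represented by their residues in \<open>{0..<p}\<close>, and equations in
  the field are congruences modulo \<open>p\<close>.
\<close>

definition Fp4 :: "nat \<Rightarrow> (int ^ 4) set" where
  "Fp4 p = {x. \<forall>i. x $ i \<in> {0..<int p}}"

definition Fp_units :: "nat \<Rightarrow> int set" where
  "Fp_units p = {1..<int p}"

definition Q4 :: "int ^ 4 \<Rightarrow> int" where
  "Q4 x = (\<Sum>i\<in>UNIV. (x $ i)\<^sup>2)"

definition dot :: "int ^ 4 \<Rightarrow> int ^ 4 \<Rightarrow> int" where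
  "dot x y = (\<Sum>i\<in>UNIV. x $ i * y $ i)"

definition sphere_p :: "nat \<Rightarrow> int \<Rightarrow> (int ^ 4) set" where
  "sphere_p p j = {x \<in> Fp4 p. [Q4 x = j] (mod int p)}"

text \<open>\<open>\<chi>(y) = e\<^bsup>2\<pi>iy/p\<^esup>\<close>; it depends only on \<open>y\<close> modulo \<open>p\<close>.\<close>

definition chi :: "nat \<Rightarrow> int \<Rightarrow> complex" where
  "chi p y = exp (2 * of_real pi * \<i> * of_int y / of_nat p)"

text \<open>
  A function \<open>f : S \<rightarrow> \<complex>\<close> is a function on all of \<open>int ^ 4\<close> of which only the values on \<open>S\<close> matter.
  The first norm below is with respect to counting measure, the second with respect to the
  uniform probability measure on \<open>S\<close>. Both are meant for \<open>0 < r < \<infinity>\<close> and finite sets.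
\<close>

definition Lnorm :: "real \<Rightarrow> (int ^ 4) set \<Rightarrow> (int ^ 4 \<Rightarrow> complex) \<Rightarrow> real" where
  "Lnorm r E g = (\<Sum>x\<in>E. cmod (g x) powr r) powr (1 / r)"

definition Lnorm_avg :: "real \<Rightarrow> (int ^ 4) set \<Rightarrow> (int ^ 4 \<Rightarrow> complex) \<Rightarrow> real" where
  "Lnorm_avg r S f = ((\<Sum>\<xi>\<in>S. cmod (f \<xi>) powr r) / real (card S)) powr (1 / r)"

definition ext_op :: "nat \<Rightarrow> (int ^ 4) set \<Rightarrow> (int ^ 4 \<Rightarrow> complex) \<Rightarrow> int ^ 4 \<Rightarrow> complex" where
  "ext_op p S f x = (\<Sum>y\<in>S. f y * chi p (dot y x)) / of_nat (card S)"

definition Lambda :: "nat \<Rightarrow> (int ^ 4) set \<Rightarrow> real \<Rightarrow> real" where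
  "Lambda p S \<theta> = Inf {l. 0 \<le> l \<and>
     (\<forall>E f. E \<subseteq> Fp4 p \<and> 1 \<le> card E \<and> real (card E) \<le> real p powr \<theta> \<longrightarrow>
        Lnorm 2 E (ext_op p S f) \<le> real p powr l * Lnorm_avg 2 S f)}"

definition Rstar :: "nat \<Rightarrow> (int ^ 4) set \<Rightarrow> real \<Rightarrow> real \<Rightarrow> real" where
  "Rstar p S q r = Inf {C. 0 \<le> C \<and>
     (\<forall>f. Lnorm r (Fp4 p) (ext_op p S f) \<le> C * Lnorm_avg q S f)}"

definition Lambda_flat :: "real \<Rightarrow> real" where
  "Lambda_flat \<theta> = (if \<theta> < 2 then 0 else if \<theta> \<le> 3 then (\<theta> - 2) / 2 else 1 / 2)"

definition odd_primes :: "nat set" where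
  "odd_primes = {p. prime p \<and> odd p}"

end

theory Submission imports Defs begin

text \<open>
  Write \<open>g\<close> for the extension of \<open>f\<close> from the sphere \<open>S\<close> and \<open>A\<close> for the averaged \<open>L\<^sup>2\<close> norm
  of \<open>f\<close>; then \<open>|g| \<le> A\<close> pointwise. Normalize to \<open>h = |g| / A \<le> 1\<close> and estimate the sum of
  \<open>h\<^sup>r\<close> over \<open>Fp4 p\<close>. The localized bounds lose a factor \<open>p\<^sup>\<epsilon>\<close>, which is harmless wherever
  \<open>h\<close> is at most a negative power of \<open>p\<close>, since \<open>r > 3\<close> leaves room. It is not harmless
  on the few points where \<open>h\<close> is close to \<open>1\<close>, so an estimate without loss is needed there.

  That estimate comes from Fourier decay. Detecting \<open>Q4 y = j\<close> by additive characters writes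
  the Fourier transform of \<open>S\<close> as an average of fourfold products of quadratic Gauss sums, and
  each product at a nonzero frequency has modulus exactly \<open>p\<^sup>2\<close>. The triangle inequality then gives
  \<open>|S| \<ge> p\<^sup>3 / 2\<close> and a normalized Fourier transform of size at most \<open>2 / p\<close> off the origin
  (\<open>sphere_p_fourier_decay\<close>). By duality, the sum of \<open>h\<^sup>2\<close> over any set of at most \<open>p\<close> points
  is at most \<open>3\<close> (\<open>ext_op_small_set\<close>).

  The space is then cut into three pieces by the size of \<open>h\<close>
  (\<open>sum_powr_le_of_localized_L2\<close>). At most \<open>p\<close> points have \<open>h\<^sup>2 > 3 / p\<close>, and there the lossless
  bound applies because \<open>h\<^sup>r \<le> h\<^sup>2\<close>. At most \<open>p\<^sup>2\<close> points have \<open>h\<close> larger than about \<open>p\<^sup>-\<^sup>1\<close>; the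
  localized bound at \<open>\<theta> = 2\<close> gives \<open>p\<^sup>2\<^sup>\<epsilon>\<close> for their sum of squares, and the loss is paid by
  \<open>h \<le> (3 / p)\<^sup>1\<^sup>/\<^sup>2\<close>. On the rest, the bound at \<open>\<theta> = 4\<close> gives \<open>p\<^sup>1\<^sup>+\<^sup>2\<^sup>\<epsilon>\<close> for the sum
  of squares, and the remaining factor \<open>h\<^sup>r\<^sup>-\<^sup>2\<close> brings this to about \<open>p\<^sup>3\<^sup>-\<^sup>r\<close>; as
  \<open>r > 3\<close>, this decay absorbs the loss once \<open>\<epsilon>\<close> is small. Finitely many small primes are covered by the trivial bound
  \<open>p\<^sup>4\<close>.
\<close>

section \<open>The additive character\<close>

lemma chi_add: "chi p (a + b) = chi p a * chi p b"
  by (simp add: chi_def algebra_simps add_divide_distrib exp_add)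

lemma chi_0 [simp]: "chi p 0 = 1"
  by (simp add: chi_def)

lemma norm_chi [simp]: "cmod (chi p a) = 1"
proof -
  have "chi p a = exp (\<i> * of_real (2 * pi * of_int a / of_nat p))"
    by (simp add: chi_def algebra_simps)
  then show ?thesis by (simp only: norm_exp_i_times)
qed

lemma chi_uminus: "chi p (- a) = cnj (chi p a)"
  by (simp add: chi_def exp_cnj)

lemma chi_sum: "finite A \<Longrightarrow> chi p (\<Sum>i\<in>A. u i) = (\<Prod>i\<in>A. chi p (u i))"
  by (induction A rule: finite_induct) (simp_all add: chi_add)

lemma chi_eq_1_iff:
  assumes "p > 0"
  shows "chi p a = 1 \<longleftrightarrow> int p dvd a"
proof -
  have e: "2 * of_real pi * \<i> * of_int a / of_nat p
      = \<i> * complex_of_real (2 * pi * of_int a / of_nat p)"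
    by (simp add: algebra_simps)
  have "chi p a = 1 \<longleftrightarrow> (\<exists>n::int. 2 * pi * of_int a / of_nat p = of_int (2 * n) * pi)"
    unfolding chi_def e exp_eq_1 by simp
  also have "\<dots> \<longleftrightarrow> (\<exists>n::int. a = int p * n)"
  proof (rule iff_exI)
    fix n :: int
    have "2 * pi * of_int a / of_nat p = of_int (2 * n) * pi \<longleftrightarrow> real_of_int a = of_int (int p * n)"
      using assms by (auto simp: field_simps)
    then show "2 * pi * of_int a / of_nat p = of_int (2 * n) * pi \<longleftrightarrow> a = int p * n"
      by (simp only: of_int_eq_iff)
  qed
  finally show ?thesis by (auto simp: dvd_def)
qed

lemma chi_cong:
  assumes "p > 0" "[a = b] (mod int p)"
  shows "chi p a = chi p b"
proof -
  have "chi p (a - b) = 1"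
    using assms by (simp add: chi_eq_1_iff cong_iff_dvd_diff)
  then show ?thesis
    using chi_add[of p "a - b" b] by simp
qed

lemma sum_residues_shift:
  fixes F :: "int \<Rightarrow> 'a::comm_monoid_add"
  assumes "p > 0" and per: "\<And>t. F (t mod int p) = F t"
  shows "(\<Sum>t\<in>{0..<int p}. F (t + u)) = (\<Sum>t\<in>{0..<int p}. F t)"
  by (rule sum.reindex_bij_witness[where i = "\<lambda>t. (t - u) mod int p" and j = "\<lambda>t. (t + u) mod int p"])
     (use assms in \<open>auto simp: mod_simps\<close>)

lemma sum_chi_residues:
  assumes "p > 0"
  shows "(\<Sum>t\<in>{0..<int p}. chi p (t * a)) = (if int p dvd a then of_nat p else 0)"
proof (cases "int p dvd a")
  case True
  then have "chi p (t * a) = 1" for t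
    using assms by (simp add: chi_eq_1_iff)
  then show ?thesis using True by simp
next
  case False
  let ?s = "\<Sum>t\<in>{0..<int p}. chi p (t * a)"
  have "?s = (\<Sum>t\<in>{0..<int p}. chi p ((t + 1) * a))"
    by (rule sum_residues_shift[symmetric, where F = "\<lambda>t. chi p (t * a)"])
       (use assms in \<open>auto intro!: chi_cong simp: cong_def mod_simps\<close>)
  also have "\<dots> = ?s * chi p a"
    by (simp add: distrib_right chi_add sum_distrib_right)
  finally have "?s * (chi p a - 1) = 0"
    by (simp add: algebra_simps)
  with False assms show ?thesis
    by (simp add: chi_eq_1_iff)
qed

section \<open>Gauss sums\<close>

text \<open>
  In the square \<open>G * cnj G\<close>, shifting one summation variable by the other makes the phase linear
  in the second variable \<open>u\<close>, with slope \<open>2 s h\<close>. Summing over \<open>u\<close> leaves only \<open>h = 0\<close>; this is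
  where \<open>p\<close> odd enters.
\<close>

lemma norm_gauss_sum:
  assumes "prime p" "odd p" "\<not> int p dvd s"
  shows "cmod (\<Sum>t\<in>{0..<int p}. chi p (s * t\<^sup>2 + t * b)) = sqrt (real p)"
proof -
  define G where "G = (\<Sum>t\<in>{0..<int p}. chi p (s * t\<^sup>2 + t * b))"
  have p0: "p > 0" using assms(1) by (simp add: prime_gt_0_nat)
  have cop: "int p dvd 2 * s * h \<longleftrightarrow> h = 0" if "h \<in> {0..<int p}" for h
  proof
    assume "int p dvd 2 * s * h"
    moreover have "\<not> int p dvd 2"
      using assms(1,2) by (metis int_dvd_int_iff of_nat_numeral primes_dvd_imp_eq two_is_prime_nat even_numeral)
    ultimately have "int p dvd h"
      using assms by (simp add: prime_dvd_mult_iff)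
    then show "h = 0" using that by (auto dest: zdvd_imp_le)
  qed simp
  have "cnj G = (\<Sum>u\<in>{0..<int p}. chi p (- (s * u\<^sup>2 + u * b)))"
    by (simp only: G_def chi_uminus cnj_sum)
  then have "G * cnj G = (\<Sum>u\<in>{0..<int p}. chi p (- (s * u\<^sup>2 + u * b)) * G)"
    by (simp only: sum_distrib_right mult.commute[of G])
  also have "\<dots> = (\<Sum>u\<in>{0..<int p}. \<Sum>h\<in>{0..<int p}.
      chi p (s * h\<^sup>2 + h * b) * chi p (u * (2 * s * h)))"
  proof (rule sum.cong[OF refl])
    fix u assume "u \<in> {0..<int p}"
    have "G = (\<Sum>h\<in>{0..<int p}. chi p (s * (h + u)\<^sup>2 + (h + u) * b))"
      unfolding G_def
      by (rule sum_residues_shift[symmetric, where F = "\<lambda>t. chi p (s * t\<^sup>2 + t * b)"])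
         (use p0 in \<open>auto intro!: chi_cong cong_add cong_mult cong_pow\<close>)
    then show "chi p (- (s * u\<^sup>2 + u * b)) * G =
        (\<Sum>h\<in>{0..<int p}. chi p (s * h\<^sup>2 + h * b) * chi p (u * (2 * s * h)))"
      by (simp add: sum_distrib_left chi_add[symmetric] algebra_simps power2_eq_square)
  qed
  also have "\<dots> = (\<Sum>h\<in>{0..<int p}. chi p (s * h\<^sup>2 + h * b) *
      (\<Sum>u\<in>{0..<int p}. chi p (u * (2 * s * h))))"
    by (subst sum.swap) (simp add: sum_distrib_left)
  also have "\<dots> = (\<Sum>h\<in>{0..<int p}. if h = 0 then of_nat p else 0)"
    by (rule sum.cong[OF refl]) (simp add: sum_chi_residues[OF p0] cop)
  also have "\<dots> = of_nat p"
    using p0 by simp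
  finally have "complex_of_real ((cmod G)\<^sup>2) = complex_of_real (real p)"
    by (simp add: complex_norm_square del: of_real_power)
  then have "(cmod G)\<^sup>2 = real p"
    by (simp only: of_real_eq_iff)
  then show ?thesis
    unfolding G_def by (simp add: real_sqrt_unique[symmetric])
qed

lemma Fp4_eq_image: "Fp4 p = vec_lambda ` (PiE UNIV (\<lambda>_. {0..<int p}))"
proof (intro set_eqI iffI)
  fix x assume "x \<in> Fp4 p"
  then show "x \<in> vec_lambda ` (PiE UNIV (\<lambda>_. {0..<int p}))"
    by (intro image_eqI[where x = "vec_nth x"]) (auto simp: Fp4_def)
qed (auto simp: Fp4_def)

lemma sum_Fp4_prod:
  fixes F :: "4 \<Rightarrow> int \<Rightarrow> complex"
  shows "(\<Sum>y\<in>Fp4 p. \<Prod>i\<in>UNIV. F i (y $ i)) = (\<Prod>i\<in>UNIV. \<Sum>t\<in>{0..<int p}. F i t)"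
proof -
  have inj: "inj_on vec_lambda (PiE UNIV (\<lambda>_::4. {0..<int p}))"
    by (auto intro!: inj_onI simp: vec_lambda_inject)
  show ?thesis
    unfolding Fp4_eq_image
    by (subst sum.reindex[OF inj], subst prod_sum_PiE) (auto simp: o_def)
qed

lemma finite_Fp4 [simp]: "finite (Fp4 p)"
  unfolding Fp4_eq_image by (intro finite_imageI finite_PiE) auto

lemma card_Fp4: "card (Fp4 p) = p ^ 4"
proof -
  have "of_nat (card (Fp4 p)) = (of_nat (p ^ 4) :: complex)"
    using sum_Fp4_prod[of "\<lambda>_ _. 1" p] by simp
  then show ?thesis by (simp only: of_nat_eq_iff)
qed

lemma norm_gauss_sum_Fp4:
  assumes "prime p" "odd p" "\<not> int p dvd s"
  shows "cmod (\<Sum>y\<in>Fp4 p. chi p (s * Q4 y + dot y z)) = (real p)\<^sup>2"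
proof -
  have "chi p (s * Q4 y + dot y z) = (\<Prod>i\<in>UNIV. chi p (s * (y $ i)\<^sup>2 + y $ i * z $ i))" for y
    by (simp add: Q4_def dot_def chi_sum[symmetric] sum_distrib_left sum.distrib)
  then have "cmod (\<Sum>y\<in>Fp4 p. chi p (s * Q4 y + dot y z)) = (sqrt (real p)) ^ 4"
    by (simp add: sum_Fp4_prod[where F = "\<lambda>i t. chi p (s * t\<^sup>2 + t * z $ i)"]
        prod_norm[symmetric] norm_gauss_sum[OF assms])
  also have "\<dots> = (real p)\<^sup>2"
    using power_mult[of "sqrt (real p)" 2 2] by simp
  finally show ?thesis .
qed

lemma sum_chi_dot_Fp4:
  assumes "p > 0"
  shows "(\<Sum>y\<in>Fp4 p. chi p (dot y z)) = (if \<forall>i. int p dvd z $ i then of_nat (p ^ 4) else 0)"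
proof -
  have "(\<Sum>y\<in>Fp4 p. chi p (dot y z)) = (\<Prod>i\<in>UNIV. if int p dvd z $ i then of_nat p else 0)"
    by (simp add: dot_def chi_sum sum_Fp4_prod[where F = "\<lambda>i t. chi p (t * z $ i)"]
        sum_chi_residues[OF assms])
  also have "\<dots> = (if \<forall>i. int p dvd z $ i then of_nat (p ^ 4) else 0)"
    by (auto simp: prod_zero_iff)
  finally show ?thesis .
qed

section \<open>Fourier decay of the sphere\<close>

lemma finite_sphere_p [simp]: "finite (sphere_p p j)"
  by (rule finite_subset[OF _ finite_Fp4[of p]]) (auto simp: sphere_p_def)

text \<open>
  Here \<open>p\<close> times the indicator of the sphere is the sum over \<open>s\<close> modulo \<open>p\<close> of
  \<open>chi p (s * (Q4 y - j))\<close>. The frequency \<open>s = 0\<close> produces the subtracted sum over the whole space,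
  and each of the other \<open>p - 1\<close> frequencies is a Gauss sum of modulus \<open>p\<^sup>2\<close>. The point \<open>z = 0\<close>
  counts the sphere, and the other \<open>z\<close> give its Fourier transform.
\<close>

lemma sphere_p_exponential_sum:
  assumes "prime p" "odd p"
  shows "cmod (of_nat p * (\<Sum>y\<in>sphere_p p j. chi p (dot y z)) - (\<Sum>y\<in>Fp4 p. chi p (dot y z)))
      \<le> (real p - 1) * (real p)\<^sup>2"
proof -
  have p0: "p > 0" using assms(1) by (simp add: prime_gt_0_nat)
  define T where "T s = chi p (- (s * j)) * (\<Sum>y\<in>Fp4 p. chi p (s * Q4 y + dot y z))" for s
  have "of_nat p * (\<Sum>y\<in>sphere_p p j. chi p (dot y z))
      = (\<Sum>y\<in>Fp4 p. (if int p dvd Q4 y - j then of_nat p else 0) * chi p (dot y z))"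
    unfolding sphere_p_def sum_distrib_left
    by (subst sum.inter_filter) (auto intro!: sum.cong simp: cong_iff_dvd_diff)
  also have "\<dots> = (\<Sum>y\<in>Fp4 p. \<Sum>s\<in>{0..<int p}. chi p (s * (Q4 y - j)) * chi p (dot y z))"
    by (simp add: sum_chi_residues[OF p0, symmetric] sum_distrib_right)
  also have "\<dots> = (\<Sum>s\<in>{0..<int p}. T s)"
    by (subst sum.swap) (simp add: T_def sum_distrib_left chi_add[symmetric] algebra_simps)
  also have "{0..<int p} = insert 0 {1..<int p}"
    using p0 by auto
  also have "(\<Sum>s\<in>insert 0 {1..<int p}. T s) = (\<Sum>y\<in>Fp4 p. chi p (dot y z)) + (\<Sum>s\<in>{1..<int p}. T s)"
    by (simp add: T_def)
  finally have "of_nat p * (\<Sum>y\<in>sphere_p p j. chi p (dot y z)) - (\<Sum>y\<in>Fp4 p. chi p (dot y z))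
      = (\<Sum>s\<in>{1..<int p}. T s)"
    by simp
  also have "cmod \<dots> \<le> (\<Sum>s\<in>{1..<int p}. (real p)\<^sup>2)"
  proof (rule sum_norm_le)
    fix s assume "s \<in> {1..<int p}"
    then have "\<not> int p dvd s" by (auto dest: zdvd_imp_le)
    then show "cmod (T s) \<le> (real p)\<^sup>2"
      by (simp add: T_def norm_mult norm_gauss_sum_Fp4[OF assms])
  qed
  also have "\<dots> = (real p - 1) * (real p)\<^sup>2"
    using p0 by (simp add: of_nat_diff nat_diff_distrib)
  finally show ?thesis .
qed

lemma card_sphere_p_ge:
  assumes "prime p" "odd p"
  shows "real (card (sphere_p p j)) \<ge> (real p) ^ 3 / 2"
proof -
  have p2: "real p \<ge> 2" using prime_ge_2_nat[OF assms(1)] by simp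
  have "cmod (of_nat p * of_nat (card (sphere_p p j)) - of_nat (p ^ 4)) \<le> (real p - 1) * (real p)\<^sup>2"
    using sphere_p_exponential_sum[OF assms, where j = j and z = 0] by (simp add: dot_def card_Fp4)
  also have "of_nat p * of_nat (card (sphere_p p j)) - of_nat (p ^ 4)
      = complex_of_real (real p * real (card (sphere_p p j)) - real p ^ 4)"
    by simp
  finally have "\<bar>real p * real (card (sphere_p p j)) - real p ^ 4\<bar> \<le> (real p - 1) * (real p)\<^sup>2"
    by (simp only: norm_of_real)
  then have "real p * real (card (sphere_p p j)) \<ge> real p ^ 4 - (real p - 1) * (real p)\<^sup>2"
    by linarith
  moreover have "real p ^ 4 - (real p - 1) * (real p)\<^sup>2 \<ge> real p * (real p ^ 3 / 2)"
  proof -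
    have "(real p)\<^sup>2 * (((real p)\<^sup>2 - 2 * real p + 2) / 2) \<ge> 0"
    proof (intro mult_nonneg_nonneg)
      show "((real p)\<^sup>2 - 2 * real p + 2) / 2 \<ge> 0"
        using zero_le_power2[of "real p - 1"] by (simp add: power2_eq_square algebra_simps)
    qed simp
    then show ?thesis
      by (simp add: power2_eq_square power3_eq_cube power4_eq_xxxx algebra_simps)
  qed
  ultimately have "real p * real (card (sphere_p p j)) \<ge> real p * (real p ^ 3 / 2)"
    by linarith
  then show ?thesis using p2 by simp
qed

lemma sphere_p_fourier_decay:
  assumes "prime p" "odd p" "x \<in> Fp4 p" "x' \<in> Fp4 p" "x \<noteq> x'"
  shows "cmod (\<Sum>y\<in>sphere_p p j. chi p (dot y (x - x'))) \<le> 2 / real p * real (card (sphere_p p j))"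
proof -
  have p0: "p > 0" using assms(1) by (simp add: prime_gt_0_nat)
  let ?K = "\<Sum>y\<in>sphere_p p j. chi p (dot y (x - x'))"
  obtain i where i: "x $ i \<noteq> x' $ i" using assms(5) by (auto simp: vec_eq_iff)
  have "x $ i \<in> {0..<int p}" "x' $ i \<in> {0..<int p}"
    using assms(3,4) by (auto simp: Fp4_def)
  with i have "\<not> int p dvd (x - x') $ i"
    by (auto simp: mod_eq_dvd_iff[symmetric])
  then have "(\<Sum>y\<in>Fp4 p. chi p (dot y (x - x'))) = 0"
    by (auto simp: sum_chi_dot_Fp4[OF p0])
  then have "real p * cmod ?K \<le> (real p - 1) * (real p)\<^sup>2"
    using sphere_p_exponential_sum[OF assms(1,2), where j = j and z = "x - x'"] by (simp add: norm_mult)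
  also have "\<dots> \<le> real p * (real p)\<^sup>2"
    by (intro mult_right_mono) auto
  finally have "cmod ?K \<le> (real p)\<^sup>2"
    using p0 by simp
  also have "\<dots> = 2 / real p * ((real p) ^ 3 / 2)"
    using p0 by (simp add: power2_eq_square power3_eq_cube)
  also have "\<dots> \<le> 2 / real p * real (card (sphere_p p j))"
    by (intro mult_left_mono card_sphere_p_ge assms) auto
  finally show ?thesis .
qed

section \<open>The extension operator on small sets\<close>

lemma Lnorm_2_power2: "(Lnorm 2 E g)\<^sup>2 = (\<Sum>x\<in>E. (cmod (g x))\<^sup>2)"
  by (simp add: Lnorm_def powr_half_sqrt sum_nonneg)

lemma Lnorm_avg_2_power2: "(Lnorm_avg 2 S f)\<^sup>2 = (\<Sum>y\<in>S. (cmod (f y))\<^sup>2) / real (card S)"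
  by (simp add: Lnorm_avg_def powr_half_sqrt sum_nonneg)

lemma Lnorm_nonneg: "Lnorm r E g \<ge> 0"
  by (simp add: Lnorm_def)

lemma Lnorm_avg_nonneg: "Lnorm_avg r S f \<ge> 0"
  by (simp add: Lnorm_avg_def)

lemma dot_diff_right: "dot y (a - b) = dot y a - dot y b"
  by (simp add: dot_def algebra_simps sum_subtractf)

lemma of_real_eq_imp_eq_norm:
  assumes "complex_of_real a = z" "a \<ge> 0"
  shows "a = cmod z"
  using assms by auto

text \<open>
  This is the \<open>T T\<^sup>*\<close> argument. Pairing the extension with itself on \<open>E\<close> and moving the adjoint to
  the other side, Cauchy-Schwarz bounds the square of \<open>n N\<close> by the \<open>L\<^sup>2\<close> mass of \<open>f\<close> times that of
  \<open>B\<close>, the adjoint applied to \<open>g\<close>. Expanding the latter gives a quadratic form in \<open>g\<close> whose kernel is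
  the Fourier transform of \<open>S\<close>: relative to \<open>n N\<close>, the diagonal contributes \<open>1\<close> and
  the off-diagonal part at most \<open>\<delta> * card E\<close> by Cauchy-Schwarz.
\<close>

lemma ext_op_L2_duality:
  assumes S: "finite S" "S \<noteq> {}" and E: "finite E" and "\<delta> \<ge> 0"
    and decay: "\<And>x x'. x \<in> E \<Longrightarrow> x' \<in> E \<Longrightarrow> x \<noteq> x' \<Longrightarrow>
      cmod (\<Sum>y\<in>S. chi p (dot y (x - x'))) \<le> \<delta> * real (card S)"
  shows "(\<Sum>x\<in>E. (cmod (ext_op p S f x))\<^sup>2) \<le> (1 + \<delta> * real (card E)) * (Lnorm_avg 2 S f)\<^sup>2"
proof -
  define g where "g = ext_op p S f"
  define n where "n = real (card S)"
  define N where "N = (\<Sum>x\<in>E. (cmod (g x))\<^sup>2)"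
  define B where "B y = (\<Sum>x\<in>E. cnj (g x) * chi p (dot y x))" for y
  define M where "M = 1 + \<delta> * real (card E)"
  have n0: "n > 0" using S by (simp add: n_def card_gt_0_iff)
  have N0: "N \<ge> 0" by (simp add: N_def sum_nonneg)
  have K: "cmod (\<Sum>y\<in>S. chi p (dot y (x - x'))) \<le> n * ((if x = x' then 1 else 0) + \<delta>)"
    if "x \<in> E" "x' \<in> E" for x x'
  proof (cases "x = x'")
    case True
    then show ?thesis using n0 \<open>\<delta> \<ge> 0\<close> by (simp add: dot_def n_def algebra_simps)
  next
    case False
    then show ?thesis using decay[OF that] by (simp add: n_def mult.commute)
  qed
  have "complex_of_real (\<Sum>y\<in>S. (cmod (B y))\<^sup>2) = (\<Sum>y\<in>S. B y * cnj (B y))"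
    by (simp add: complex_norm_square del: of_real_power)
  also have "\<dots> = (\<Sum>y\<in>S. \<Sum>x\<in>E. \<Sum>x'\<in>E. cnj (g x) * g x' * chi p (dot y (x - x')))"
  proof (rule sum.cong[OF refl])
    fix y
    have "chi p (dot y (x - x')) = chi p (dot y x) * cnj (chi p (dot y x'))" for x x'
      using chi_add[of p "dot y x" "- dot y x'"] by (simp add: dot_diff_right chi_uminus)
    then show "B y * cnj (B y) = (\<Sum>x\<in>E. \<Sum>x'\<in>E. cnj (g x) * g x' * chi p (dot y (x - x')))"
      by (simp add: B_def sum_product mult_ac) (subst sum.swap, rule refl)
  qed
  also have "\<dots> = (\<Sum>x\<in>E. \<Sum>x'\<in>E. cnj (g x) * g x' * (\<Sum>y\<in>S. chi p (dot y (x - x'))))"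
    by (subst sum.swap, rule sum.cong[OF refl], subst sum.swap) (simp add: sum_distrib_left)
  finally have "(\<Sum>y\<in>S. (cmod (B y))\<^sup>2)
      = cmod (\<Sum>x\<in>E. \<Sum>x'\<in>E. cnj (g x) * g x' * (\<Sum>y\<in>S. chi p (dot y (x - x'))))"
    by (rule of_real_eq_imp_eq_norm) (simp add: sum_nonneg)
  also have "\<dots> \<le> (\<Sum>x\<in>E. \<Sum>x'\<in>E. cmod (g x) * cmod (g x') * (n * ((if x = x' then 1 else 0) + \<delta>)))"
    by (intro sum_norm_le, simp only: norm_mult complex_mod_cnj)
       (intro mult_left_mono K mult_nonneg_nonneg norm_ge_zero)
  also have "\<dots> = n * (N + \<delta> * (\<Sum>x\<in>E. cmod (g x))\<^sup>2)"
  proof -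
    have "(\<Sum>x\<in>E. \<Sum>x'\<in>E. cmod (g x) * cmod (g x') * (n * ((if x = x' then 1 else 0) + \<delta>)))
      = n * (\<Sum>x\<in>E. \<Sum>x'\<in>E. (if x = x' then cmod (g x) * cmod (g x') else 0) + \<delta> * (cmod (g x) * cmod (g x')))"
      unfolding sum_distrib_left by (intro sum.cong refl) (auto simp: algebra_simps)
    also have "(\<Sum>x\<in>E. \<Sum>x'\<in>E. (if x = x' then cmod (g x) * cmod (g x') else 0) + \<delta> * (cmod (g x) * cmod (g x')))
       = N + \<delta> * (\<Sum>x\<in>E. cmod (g x))\<^sup>2"
      unfolding power2_eq_square sum_product
      by (simp add: sum.distrib E N_def power2_eq_square sum_distrib_left)
    finally show ?thesis .
  qed
  also have "\<dots> \<le> n * (N + \<delta> * (real (card E) * N))"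
  proof -
    have "(\<Sum>x\<in>E. cmod (g x))\<^sup>2 \<le> real (card E) * N"
      using Cauchy_Schwarz_ineq_sum[of "\<lambda>_. 1" "\<lambda>x. cmod (g x)" E] by (simp add: N_def)
    then show ?thesis using n0 \<open>\<delta> \<ge> 0\<close> by (intro mult_left_mono add_left_mono) auto
  qed
  finally have B: "(\<Sum>y\<in>S. (cmod (B y))\<^sup>2) \<le> n * (M * N)"
    by (simp add: M_def algebra_simps)
  have "complex_of_real (n * N) = of_nat (card S) * (\<Sum>x\<in>E. cnj (g x) * g x)"
    by (simp add: N_def n_def complex_norm_square mult.commute del: of_real_power)
  also have "\<dots> = (\<Sum>x\<in>E. \<Sum>y\<in>S. cnj (g x) * (f y * chi p (dot y x)))"
  proof -
    have "of_nat (card S) * g x = (\<Sum>y\<in>S. f y * chi p (dot y x))" for x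
      using S by (simp add: g_def ext_op_def)
    then have "of_nat (card S) * (cnj (g x) * g x) = (\<Sum>y\<in>S. cnj (g x) * (f y * chi p (dot y x)))" for x
      by (simp only: mult.left_commute[of _ "cnj (g x)"] sum_distrib_left[symmetric])
    then show ?thesis
      by (simp only: sum_distrib_left)
  qed
  also have "\<dots> = (\<Sum>y\<in>S. f y * B y)"
    by (subst sum.swap) (simp add: B_def sum_distrib_left mult_ac)
  finally have "n * N = cmod (\<Sum>y\<in>S. f y * B y)"
    by (rule of_real_eq_imp_eq_norm) (use n0 N0 in simp)
  also have "\<dots> \<le> (\<Sum>y\<in>S. cmod (f y) * cmod (B y))"
    by (intro sum_norm_le) (simp add: norm_mult)
  finally have "(n * N)\<^sup>2 \<le> (\<Sum>y\<in>S. cmod (f y) * cmod (B y))\<^sup>2"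
    using n0 N0 by (intro power_mono) auto
  also have "\<dots> \<le> (\<Sum>y\<in>S. (cmod (f y))\<^sup>2) * (\<Sum>y\<in>S. (cmod (B y))\<^sup>2)"
    by (rule Cauchy_Schwarz_ineq_sum)
  also have "\<dots> \<le> (\<Sum>y\<in>S. (cmod (f y))\<^sup>2) * (n * (M * N))"
    by (intro mult_left_mono B sum_nonneg) auto
  also have "(\<Sum>y\<in>S. (cmod (f y))\<^sup>2) = n * (Lnorm_avg 2 S f)\<^sup>2"
    using n0 by (simp add: Lnorm_avg_2_power2 n_def)
  finally have "n\<^sup>2 * (N * N) \<le> n\<^sup>2 * (N * (M * (Lnorm_avg 2 S f)\<^sup>2))"
    by (simp add: power2_eq_square mult_ac)
  then have *: "N * N \<le> N * (M * (Lnorm_avg 2 S f)\<^sup>2)"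
    using n0 by simp
  have "N \<le> M * (Lnorm_avg 2 S f)\<^sup>2"
  proof (cases "N = 0")
    case True
    then show ?thesis using \<open>\<delta> \<ge> 0\<close> by (simp add: M_def)
  next
    case False
    then show ?thesis using * N0 by simp
  qed
  then show ?thesis by (simp add: N_def M_def g_def)
qed

text \<open>On a single point the decay condition is vacuous, so \<open>\<delta> = 0\<close> is admissible.\<close>

lemma ext_op_le_avg:
  assumes "finite S" "S \<noteq> {}"
  shows "cmod (ext_op p S f x) \<le> Lnorm_avg 2 S f"
proof -
  have "(cmod (ext_op p S f x))\<^sup>2 \<le> (Lnorm_avg 2 S f)\<^sup>2"
    using ext_op_L2_duality[OF assms, of "{x}" 0 p f] by simp
  then show ?thesis
    by (rule power2_le_imp_le) (rule Lnorm_avg_nonneg)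
qed

lemma sphere_p_nonempty:
  assumes "prime p" "odd p"
  shows "sphere_p p j \<noteq> {}"
proof -
  have "real p ^ 3 / 2 > 0" using prime_gt_0_nat[OF assms(1)] by simp
  then show ?thesis using card_sphere_p_ge[OF assms, of j] by auto
qed

lemma ext_op_small_set:
  assumes "prime p" "odd p" "E \<subseteq> Fp4 p" "card E \<le> p"
  shows "(\<Sum>x\<in>E. (cmod (ext_op p (sphere_p p j) f x))\<^sup>2) \<le> 3 * (Lnorm_avg 2 (sphere_p p j) f)\<^sup>2"
proof -
  have p0: "p > 0" using assms(1) by (simp add: prime_gt_0_nat)
  have "(\<Sum>x\<in>E. (cmod (ext_op p (sphere_p p j) f x))\<^sup>2)
      \<le> (1 + 2 / real p * real (card E)) * (Lnorm_avg 2 (sphere_p p j) f)\<^sup>2"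
    using assms finite_subset[OF assms(3)]
    by (intro ext_op_L2_duality sphere_p_nonempty sphere_p_fourier_decay) auto
  also have "\<dots> \<le> 3 * (Lnorm_avg 2 (sphere_p p j) f)\<^sup>2"
    using assms(4) p0 by (intro mult_right_mono) (auto simp: field_simps)
  finally show ?thesis .
qed

section \<open>Using the localized bounds\<close>

text \<open>
  A strict upper bound on the infimum \<open>Lambda\<close> yields an admissible exponent below \<open>l\<close>, provided that
  some exponent is admissible at all: otherwise the infimum is taken over the empty set and
  carries no information. The pointwise bound shows that \<open>2\<close> is always admissible, as
  the space has \<open>p ^ 4\<close> points.
\<close>

lemma ext_op_localized:
  assumes "prime p" "odd p" "Lambda p (sphere_p p j) \<theta> < l"
    and "E \<subseteq> Fp4 p" "real (card E) \<le> real p powr \<theta>"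
  shows "(\<Sum>x\<in>E. (cmod (ext_op p (sphere_p p j) f x))\<^sup>2)
    \<le> real p powr (2 * l) * (Lnorm_avg 2 (sphere_p p j) f)\<^sup>2"
proof (cases "E = {}")
  case False
  have p1: "real p > 1" using prime_gt_1_nat[OF assms(1)] by simp
  let ?S = "sphere_p p j"
  define X where "X = {l. 0 \<le> l \<and>
     (\<forall>E f. E \<subseteq> Fp4 p \<and> 1 \<le> card E \<and> real (card E) \<le> real p powr \<theta> \<longrightarrow>
        Lnorm 2 E (ext_op p ?S f) \<le> real p powr l * Lnorm_avg 2 ?S f)}"
  have "2 \<in> X"
  proof -
    have "Lnorm 2 E (ext_op p ?S f) \<le> real p powr 2 * Lnorm_avg 2 ?S f"
      if E: "E \<subseteq> Fp4 p" for E f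
    proof -
      have "(Lnorm 2 E (ext_op p ?S f))\<^sup>2 \<le> (\<Sum>x\<in>E. (Lnorm_avg 2 ?S f)\<^sup>2)"
        unfolding Lnorm_2_power2
        by (intro sum_mono power_mono ext_op_le_avg sphere_p_nonempty assms) auto
      also have "\<dots> \<le> real (p ^ 4) * (Lnorm_avg 2 ?S f)\<^sup>2"
        using card_mono[OF finite_Fp4 E]
        by (simp only: card_Fp4 sum_constant of_nat_le_iff mult_right_mono zero_le_power2)
      also have "\<dots> = (real p powr 2 * Lnorm_avg 2 ?S f)\<^sup>2"
        using p1 by (simp add: power_mult_distrib flip: power_mult)
      finally show ?thesis
        by (rule power2_le_imp_le) (simp add: Lnorm_avg_nonneg)
    qed
    then show ?thesis by (simp add: X_def)
  qed
  moreover have "Inf X < l"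
    using assms(3) by (simp add: Lambda_def X_def)
  ultimately obtain l' where l': "l' \<in> X" "l' < l"
    using cInf_lessD by blast
  have "card E \<ge> 1"
    using False finite_subset[OF assms(4)] by (simp add: Suc_le_eq card_gt_0_iff)
  then have "Lnorm 2 E (ext_op p ?S f) \<le> real p powr l' * Lnorm_avg 2 ?S f"
    using l'(1) assms(4,5) unfolding X_def by blast
  also have "\<dots> \<le> real p powr l * Lnorm_avg 2 ?S f"
    using p1 l'(2) by (intro mult_right_mono Lnorm_avg_nonneg) simp
  finally have "(Lnorm 2 E (ext_op p ?S f))\<^sup>2 \<le> (real p powr l * Lnorm_avg 2 ?S f)\<^sup>2"
    by (intro power_mono Lnorm_nonneg)
  also have "\<dots> = real p powr (2 * l) * (Lnorm_avg 2 ?S f)\<^sup>2"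
    by (simp add: power2_eq_square powr_add[symmetric])
  finally show ?thesis by (simp add: Lnorm_2_power2)
qed simp

section \<open>Summing over level sets\<close>

text \<open>
  If there were more than \<open>m\<close> such points, exactly \<open>m\<close> of them would already have sum above \<open>B\<close>.
  Hence a bound for sums over small sets forces the set of large values to be small itself, and
  the same bound then applies to it.
\<close>

lemma card_large_values_le:
  fixes v :: "'a \<Rightarrow> real"
  assumes "m > 0" and bound: "\<And>E. E \<subseteq> G \<Longrightarrow> card E \<le> m \<Longrightarrow> (\<Sum>x\<in>E. v x) \<le> B"
  shows "card {x\<in>G. v x > B / real m} \<le> m"
proof (rule ccontr)
  assume "\<not> card {x\<in>G. v x > B / real m} \<le> m"
  then obtain E where E: "E \<subseteq> {x\<in>G. v x > B / real m}" "card E = m"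
    by (metis nat_le_linear obtain_subset_with_card_n)
  have "finite E" "E \<noteq> {}" using E(2) assms(1) card_gt_0_iff by force+
  then have "(\<Sum>x\<in>E. B / real m) < (\<Sum>x\<in>E. v x)"
    using E(1) by (intro sum_strict_mono) auto
  moreover have "(\<Sum>x\<in>E. B / real m) = B"
    using E(2) assms(1) by simp
  moreover have "(\<Sum>x\<in>E. v x) \<le> B"
    using E by (intro bound) auto
  ultimately show False by simp
qed

text \<open>Split \<open>h\<^sup>r\<close> as \<open>h\<^sup>2\<close> times \<open>h\<^sup>r\<^sup>-\<^sup>2\<close> and bound the second factor by the level.\<close>

lemma sum_powr_le_on_level:
  fixes h :: "'a \<Rightarrow> real"
  assumes "r \<ge> 2" "\<And>x. x \<in> F \<Longrightarrow> 0 \<le> h x" "\<And>x. x \<in> F \<Longrightarrow> (h x)\<^sup>2 \<le> T"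
    and "(\<Sum>x\<in>F. (h x)\<^sup>2) \<le> B" "T \<ge> 0"
  shows "(\<Sum>x\<in>F. h x powr r) \<le> T powr ((r - 2) / 2) * B"
proof -
  have "h x powr r \<le> T powr ((r - 2) / 2) * (h x)\<^sup>2" if x: "x \<in> F" for x
  proof (cases "h x = 0")
    case False
    then have h: "h x > 0" using assms(2)[OF x] by simp
    then have "h x powr r = ((h x)\<^sup>2) powr ((r - 2) / 2) * (h x)\<^sup>2"
      by (simp flip: powr_numeral add: powr_powr powr_add[symmetric] diff_divide_distrib)
    also have "\<dots> \<le> T powr ((r - 2) / 2) * (h x)\<^sup>2"
      using assms(1) assms(3)[OF x] by (intro mult_right_mono powr_mono2) (use x assms in auto)
    finally show ?thesis .
  qed simp
  then have "(\<Sum>x\<in>F. h x powr r) \<le> T powr ((r - 2) / 2) * (\<Sum>x\<in>F. (h x)\<^sup>2)"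
    unfolding sum_distrib_left by (rule sum_mono)
  also have "\<dots> \<le> T powr ((r - 2) / 2) * B"
    using assms(4) by (intro mult_left_mono) auto
  finally show ?thesis .
qed

text \<open>
  The three terms of the bound belong to the sets \<open>E1\<close>, \<open>E2 - E1\<close> and the rest, on which \<open>h\<^sup>2\<close> is
  at most \<open>1\<close>, \<open>K / p\<close> and \<open>p powr (2 * \<epsilon> - 2)\<close>. The exponents of \<open>p\<close> that remain are \<open>0\<close>,
  \<open>2 * \<epsilon> - (r - 2) / 2\<close> and \<open>3 - r + \<epsilon> * r\<close>; the conditions on \<open>\<epsilon>\<close> are what makes the last two
  nonpositive.
\<close>

lemma sum_powr_le_of_localized_L2:
  fixes h :: "'a \<Rightarrow> real" and p :: nat
  assumes G: "finite G" and h: "\<And>x. x \<in> G \<Longrightarrow> 0 \<le> h x" "\<And>x. x \<in> G \<Longrightarrow> h x \<le> 1"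
    and p: "p \<ge> 1" and r: "r > 3" and \<epsilon>: "\<epsilon> \<ge> 0" "\<epsilon> \<le> 1/4" "\<epsilon> * r \<le> r - 3"
    and K: "K \<ge> 1"
    and small: "\<And>E. E \<subseteq> G \<Longrightarrow> card E \<le> p \<Longrightarrow> (\<Sum>x\<in>E. (h x)\<^sup>2) \<le> K"
    and medium: "\<And>E. E \<subseteq> G \<Longrightarrow> card E \<le> p\<^sup>2 \<Longrightarrow> (\<Sum>x\<in>E. (h x)\<^sup>2) \<le> real p powr (2 * \<epsilon>)"
    and all: "(\<Sum>x\<in>G. (h x)\<^sup>2) \<le> real p powr (1 + 2 * \<epsilon>)"
  shows "(\<Sum>x\<in>G. h x powr r) \<le> K + K powr ((r - 2) / 2) + 1"
proof -
  define q where "q = real p"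
  define s where "s = (r - 2) / 2"
  define E1 where "E1 = {x\<in>G. (h x)\<^sup>2 > K / real p}"
  define E2 where "E2 = {x\<in>G. (h x)\<^sup>2 > (real p powr (2 * \<epsilon>)) / real (p\<^sup>2)}"
  have q1: "q \<ge> 1" using p by (simp add: q_def)
  have s: "s \<ge> 1/2" using r by (simp add: s_def)
  have q_mono: "q powr a \<le> 1" if "a \<le> 0" for a
    using powr_mono[OF that q1] q1 by simp
  have "card E1 \<le> p" unfolding E1_def using p
    by (intro card_large_values_le small) auto
  then have E1: "(\<Sum>x\<in>E1. (h x)\<^sup>2) \<le> K" by (intro small) (auto simp: E1_def)
  have "card E2 \<le> p\<^sup>2" unfolding E2_def using p
    by (intro card_large_values_le medium) auto
  then have E2: "(\<Sum>x\<in>E2. (h x)\<^sup>2) \<le> q powr (2 * \<epsilon>)"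
    unfolding q_def by (intro medium) (auto simp: E2_def)
  have fin: "finite E1" "finite E2" using G by (auto simp: E1_def E2_def)
  have "(\<Sum>x\<in>E1. h x powr r) \<le> 1 powr s * K"
    unfolding s_def using r h E1 by (intro sum_powr_le_on_level) (auto simp: E1_def power_le_one)
  then have sum1: "(\<Sum>x\<in>E1. h x powr r) \<le> K" by simp
  have "(\<Sum>x\<in>E2 - E1. (h x)\<^sup>2) \<le> q powr (2 * \<epsilon>)"
    by (rule order_trans[OF sum_mono2 E2]) (use fin in auto)
  then have "(\<Sum>x\<in>E2 - E1. h x powr r) \<le> (K / q) powr s * q powr (2 * \<epsilon>)"
    unfolding s_def using r h K q1
    by (intro sum_powr_le_on_level) (auto simp: E1_def E2_def q_def not_less)
  also have "\<dots> = K powr s * q powr (2 * \<epsilon> - s)"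
    using K q1 by (simp add: powr_divide powr_diff)
  also have "\<dots> \<le> K powr s"
    using q_mono[of "2 * \<epsilon> - s"] s \<epsilon> by (simp add: mult_left_le)
  finally have sum2: "(\<Sum>x\<in>E2 - E1. h x powr r) \<le> K powr s" .
  have "(\<Sum>x\<in>G - E1 - E2. (h x)\<^sup>2) \<le> q powr (1 + 2 * \<epsilon>)"
    unfolding q_def by (rule order_trans[OF sum_mono2 all]) (use G in auto)
  then have "(\<Sum>x\<in>G - E1 - E2. h x powr r) \<le> (q powr (2 * \<epsilon>) / q\<^sup>2) powr s * q powr (1 + 2 * \<epsilon>)"
    unfolding s_def using r h
    by (intro sum_powr_le_on_level) (auto simp: E2_def q_def not_less)
  also have "q powr (2 * \<epsilon>) / q\<^sup>2 = q powr (2 * \<epsilon> - 2)"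
    using q1 by (simp add: powr_diff)
  also have "(q powr (2 * \<epsilon> - 2)) powr s * q powr (1 + 2 * \<epsilon>) = q powr (3 - r + \<epsilon> * r)"
  proof -
    have "(2 * \<epsilon> - 2) * s + (1 + 2 * \<epsilon>) = 3 - r + \<epsilon> * r"
      by (simp add: s_def field_simps)
    then show ?thesis by (simp only: powr_powr powr_add[symmetric])
  qed
  also have "\<dots> \<le> 1"
    using \<epsilon>(3) by (intro q_mono) simp
  finally have sum3: "(\<Sum>x\<in>G - E1 - E2. h x powr r) \<le> 1" .
  have "G = E1 \<union> (E2 - E1) \<union> (G - E1 - E2)"
    by (auto simp: E1_def E2_def)
  then have "(\<Sum>x\<in>G. h x powr r) = (\<Sum>x\<in>E1 \<union> (E2 - E1) \<union> (G - E1 - E2). h x powr r)"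
    by simp
  also have "\<dots> = (\<Sum>x\<in>E1. h x powr r) + (\<Sum>x\<in>E2 - E1. h x powr r) + (\<Sum>x\<in>G - E1 - E2. h x powr r)"
    using fin G by (subst sum.union_disjoint; (subst sum.union_disjoint)?) auto
  also have "\<dots> \<le> K + K powr s + 1"
    using sum1 sum2 sum3 by linarith
  finally show ?thesis by (simp add: s_def)
qed

section \<open>The global extension estimate\<close>

lemma Lambda_bounds_from_uniform_limit:
  assumes lim: "uniform_limit {0..4}
             (\<lambda>p \<theta>. SUP j\<in>Fp_units p. Lambda p (sphere_p p j) \<theta>)
             Lambda_flat
             (inf at_top (principal odd_primes))"
    and "\<epsilon> > 0"
  obtains P where "\<And>p j \<theta>. p \<in> odd_primes \<Longrightarrow> p \<ge> P \<Longrightarrow> j \<in> Fp_units p \<Longrightarrow> \<theta> \<in> {0..4} \<Longrightarrow>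
      Lambda p (sphere_p p j) \<theta> < Lambda_flat \<theta> + \<epsilon>"
proof -
  have "\<forall>\<^sub>F p in inf at_top (principal odd_primes). \<forall>\<theta>\<in>{0..4}.
      dist (SUP j\<in>Fp_units p. Lambda p (sphere_p p j) \<theta>) (Lambda_flat \<theta>) < \<epsilon>"
    using uniform_limitD[OF lim \<open>\<epsilon> > 0\<close>] by simp
  then obtain P where P: "\<And>p \<theta>. p \<ge> P \<Longrightarrow> p \<in> odd_primes \<Longrightarrow> \<theta> \<in> {0..4} \<Longrightarrow>
      dist (SUP j\<in>Fp_units p. Lambda p (sphere_p p j) \<theta>) (Lambda_flat \<theta>) < \<epsilon>"
    unfolding eventually_inf_principal eventually_at_top_linorder by blast
  show ?thesis
  proof (rule that[of P])
    fix p j \<theta> assume a: "p \<in> odd_primes" "p \<ge> P" "j \<in> Fp_units p" "\<theta> \<in> {0..4::real}"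
    have "Lambda p (sphere_p p j) \<theta> \<le> (SUP j\<in>Fp_units p. Lambda p (sphere_p p j) \<theta>)"
      by (intro cSUP_upper a bdd_above_finite) (simp add: Fp_units_def)
    also have "\<dots> < Lambda_flat \<theta> + \<epsilon>"
      using P[OF a(2,1,4)] unfolding dist_real_def by linarith
    finally show "Lambda p (sphere_p p j) \<theta> < Lambda_flat \<theta> + \<epsilon>" .
  qed
qed

text \<open>
  The normalized estimate makes sense only for \<open>A > 0\<close>; for \<open>A = 0\<close> the pointwise bound forces
  \<open>g = 0\<close> on \<open>G\<close>.
\<close>

lemma Lnorm_le_of_normalized:
  assumes "finite G" "A \<ge> 0" "r > 1" "C \<ge> 1" and sup: "\<And>x. x \<in> G \<Longrightarrow> cmod (g x) \<le> A"
    and norm: "A > 0 \<Longrightarrow> (\<Sum>x\<in>G. (cmod (g x) / A) powr r) \<le> C"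
  shows "Lnorm r G g \<le> C * A"
proof (cases "A = 0")
  case True
  then have "g x = 0" if "x \<in> G" for x using sup[OF that] by simp
  then show ?thesis using True by (simp add: Lnorm_def)
next
  case False
  then have A: "A > 0" using assms(2) by simp
  have "(\<Sum>x\<in>G. cmod (g x) powr r) = A powr r * (\<Sum>x\<in>G. (cmod (g x) / A) powr r)"
    using A by (simp add: sum_distrib_left powr_divide)
  also have "\<dots> \<le> A powr r * C"
    using norm[OF A] by (intro mult_left_mono) auto
  finally have "Lnorm r G g \<le> (A powr r * C) powr (1 / r)"
    unfolding Lnorm_def using assms(3) by (intro powr_mono2) (auto intro: sum_nonneg)
  also have "\<dots> = A * C powr (1 / r)"
    using A assms(3,4) by (simp add: powr_mult powr_powr)
  also have "\<dots> \<le> A * C powr 1"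
    using A assms(3,4) by (intro mult_left_mono powr_mono) auto
  finally show ?thesis using assms(4) by (simp add: mult.commute)
qed

theorem corollary1p5:
  fixes r :: real
  assumes "uniform_limit {0..4}
             (\<lambda>p \<theta>. SUP j\<in>Fp_units p. Lambda p (sphere_p p j) \<theta>)
             Lambda_flat
             (inf at_top (principal odd_primes))"
    and "r > 3"
  shows "\<exists>C. \<forall>p\<in>odd_primes. \<forall>j\<in>Fp_units p.
           Rstar p (sphere_p p j) 2 r \<le> C \<and>
           (\<forall>f. Lnorm r (Fp4 p) (ext_op p (sphere_p p j) f)
                  \<le> C * Lnorm_avg 2 (sphere_p p j) f)"
proof -
  define \<epsilon> where "\<epsilon> = min (1/4) ((r - 3) / r)"
  have \<epsilon>: "\<epsilon> > 0" "\<epsilon> \<le> 1/4" "\<epsilon> * r \<le> r - 3"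
    using assms(2) by (auto simp: \<epsilon>_def min_def field_simps)
  obtain P where P: "\<And>p j \<theta>. p \<in> odd_primes \<Longrightarrow> p \<ge> P \<Longrightarrow> j \<in> Fp_units p \<Longrightarrow> \<theta> \<in> {0..4} \<Longrightarrow>
      Lambda p (sphere_p p j) \<theta> < Lambda_flat \<theta> + \<epsilon>"
    using Lambda_bounds_from_uniform_limit[OF assms(1) \<epsilon>(1)] by blast
  \<comment> \<open>The last summand covers the primes below \<open>P\<close>, the others come from the level sets with \<open>K = 3\<close>.\<close>
  define C where "C = 3 + 3 powr ((r - 2) / 2) + 1 + real P ^ 4"
  have C1: "C \<ge> 1" by (simp add: C_def add.assoc)
  have bound: "Lnorm r (Fp4 p) (ext_op p (sphere_p p j) f) \<le> C * Lnorm_avg 2 (sphere_p p j) f"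
    if p: "p \<in> odd_primes" and j: "j \<in> Fp_units p" for p j f
  proof (rule Lnorm_le_of_normalized)
    let ?S = "sphere_p p j" and ?g = "ext_op p (sphere_p p j) f"
    let ?A = "Lnorm_avg 2 (sphere_p p j) f"
    have pr: "prime p" "odd p" using p by (auto simp: odd_primes_def)
    have p1: "p \<ge> 1" using prime_ge_1_nat[OF pr(1)] .
    show sup: "cmod (?g x) \<le> ?A" for x
      by (intro ext_op_le_avg sphere_p_nonempty pr) simp
    assume A: "?A > 0"
    have normalize: "(\<Sum>x\<in>E. (cmod (?g x) / ?A)\<^sup>2) \<le> b"
      if "(\<Sum>x\<in>E. (cmod (?g x))\<^sup>2) \<le> b * ?A\<^sup>2" for E b
      using that A by (simp add: power_divide field_simps flip: sum_divide_distrib)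
    show "(\<Sum>x\<in>Fp4 p. (cmod (?g x) / ?A) powr r) \<le> C"
    proof (cases "p \<ge> P")
      case True
      have "(\<Sum>x\<in>Fp4 p. (cmod (?g x) / ?A) powr r) \<le> 3 + 3 powr ((r - 2) / 2) + 1"
      proof (rule sum_powr_le_of_localized_L2[where p = p and \<epsilon> = \<epsilon>])
        fix E assume E: "E \<subseteq> Fp4 p" "card E \<le> p"
        show "(\<Sum>x\<in>E. (cmod (?g x) / ?A)\<^sup>2) \<le> 3"
          by (intro normalize ext_op_small_set pr E)
      next
        fix E assume E: "E \<subseteq> Fp4 p" "card E \<le> p\<^sup>2"
        have "Lambda p ?S 2 < \<epsilon>"
          using P[OF p True j, of 2] by (simp add: Lambda_flat_def)
        moreover have "real (card E) \<le> real p powr 2"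
          using E(2) p1 by (simp flip: of_nat_power)
        ultimately show "(\<Sum>x\<in>E. (cmod (?g x) / ?A)\<^sup>2) \<le> real p powr (2 * \<epsilon>)"
          by (intro normalize ext_op_localized pr E)
      next
        have "Lambda p ?S 4 < 1 / 2 + \<epsilon>"
          using P[OF p True j, of 4] by (simp add: Lambda_flat_def)
        moreover have "real (card (Fp4 p)) \<le> real p powr 4"
          using p1 by (simp add: card_Fp4)
        ultimately have "(\<Sum>x\<in>Fp4 p. (cmod (?g x) / ?A)\<^sup>2) \<le> real p powr (2 * (1 / 2 + \<epsilon>))"
          by (intro normalize ext_op_localized pr) auto
        then show "(\<Sum>x\<in>Fp4 p. (cmod (?g x) / ?A)\<^sup>2) \<le> real p powr (1 + 2 * \<epsilon>)"
          by simp
      qed (use \<epsilon> assms(2) p1 A sup in auto)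
      then show ?thesis by (simp add: C_def add_increasing2)
    next
      case False
      have "(\<Sum>x\<in>Fp4 p. (cmod (?g x) / ?A) powr r) \<le> (\<Sum>x\<in>Fp4 p. 1)"
        using A sup assms(2) by (intro sum_mono powr_le1) auto
      also have "\<dots> = real p ^ 4"
        by (simp add: card_Fp4)
      also have "\<dots> \<le> real P ^ 4"
        using False by (intro power_mono) auto
      also have "\<dots> \<le> C"
        by (simp add: C_def)
      finally show ?thesis .
    qed
  qed (use C1 assms(2) in \<open>auto simp: Lnorm_avg_nonneg\<close>)
  have "Rstar p (sphere_p p j) 2 r \<le> C" if "p \<in> odd_primes" "j \<in> Fp_units p" for p j
    unfolding Rstar_def
    using bound[OF that] C1 by (intro cInf_lower bdd_belowI[of _ 0]) auto
  with bound show ?thesis by blast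
qed

end
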